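(* Let $h_1\ge\dots\ge h_n>0$ be integers and $N=h_1+\dots+h_n$. If a $\mathrm{LC}(h_1\dots h_n)$ exists, then for every subset $D\subseteq\{1,\dots,n\}$, $$N^3-\sum_{i=1}^n h_i^3\;\ge\; N^2\sum_{i\in D}h_i+3\Big(\sum_{i\in D}h_i^2\Big)\Big(N-\sum_{i\in D}h_i\Big)-\sum_{i\in D}h_i^3.$$
   Context: A latin cube of order $N$ is an $N\times N\times N$ array on $N$ symbols such that any two cells whose coordinates differ in exactly one position contain different symbols; a subcube is an $m\times m\times m$ subarray (indices in each coordinate from chosen $m$-sets) that is itself a latin cube of order $m$; subcubes are disjoint if they share no index in any coordinate and no symbol. A $\mathrm{LC}(h_1\dots h_n)$ is a latin cube of order $N=\sum h_i$ with pairwise disjoint subcubes of orders $h_1,\dots,h_n$. *)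

theory Defs
  imports Main
begin

text \<open>
  \<open>latin_array R C F S m L\<close>: the restriction of \<open>L\<close> to the cells \<open>R \<times> C \<times> F\<close> is a latin cube
  of order \<open>m\<close> on the symbol set \<open>S\<close>.  The three injectivity conditions say that two cells
  differing in exactly one coordinate contain different symbols.  Finiteness is explicit because
  the cardinality of an infinite set is \<open>0\<close>.
\<close>

definition latin_array ::
  "'i set \<Rightarrow> 'i set \<Rightarrow> 'i set \<Rightarrow> 's set \<Rightarrow> nat \<Rightarrow> ('i \<Rightarrow> 'i \<Rightarrow> 'i \<Rightarrow> 's) \<Rightarrow> bool" where
  "latin_array R C F S m L \<longleftrightarrow>
     finite R \<and> card R = m \<and> finite C \<and> card C = m \<and> finite F \<and> card F = m \<and>
     finite S \<and> card S = m \<and>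
     (\<forall>r\<in>R. \<forall>c\<in>C. \<forall>f\<in>F. L r c f \<in> S) \<and>
     (\<forall>c\<in>C. \<forall>f\<in>F. inj_on (\<lambda>r. L r c f) R) \<and>
     (\<forall>r\<in>R. \<forall>f\<in>F. inj_on (\<lambda>c. L r c f) C) \<and>
     (\<forall>r\<in>R. \<forall>c\<in>C. inj_on (\<lambda>f. L r c f) F)"

definition latin_cube :: "nat \<Rightarrow> 's set \<Rightarrow> (nat \<Rightarrow> nat \<Rightarrow> nat \<Rightarrow> 's) \<Rightarrow> bool" where
  "latin_cube N S L \<longleftrightarrow> latin_array {1..N} {1..N} {1..N} S N L"

definition subcube ::
  "nat \<Rightarrow> 's set \<Rightarrow> (nat \<Rightarrow> nat \<Rightarrow> nat \<Rightarrow> 's) \<Rightarrow>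
   nat \<Rightarrow> nat set \<Rightarrow> nat set \<Rightarrow> nat set \<Rightarrow> 's set \<Rightarrow> bool" where
  "subcube N S L m R C F T \<longleftrightarrow>
     R \<subseteq> {1..N} \<and> C \<subseteq> {1..N} \<and> F \<subseteq> {1..N} \<and> T \<subseteq> S \<and> latin_array R C F T m L"

text \<open>
  \<open>is_LC n h S L\<close>: \<open>L\<close> is an LC(\<open>h 1 \<dots> h n\<close>) on the symbol set \<open>S\<close>.  The \<open>i\<close>-th subcube
  occupies the cells \<open>R i \<times> C i \<times> F i\<close> and uses the symbols \<open>T i\<close>.  Values of \<open>h\<close> outside
  \<open>{1..n}\<close> are irrelevant.
\<close>

definition is_LC ::
  "nat \<Rightarrow> (nat \<Rightarrow> nat) \<Rightarrow> 's set \<Rightarrow> (nat \<Rightarrow> nat \<Rightarrow> nat \<Rightarrow> 's) \<Rightarrow> bool" where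
  "is_LC n h S L \<longleftrightarrow>
     latin_cube (\<Sum>i=1..n. h i) S L \<and>
     (\<exists>R C F T.
        (\<forall>i\<in>{1..n}. subcube (\<Sum>i=1..n. h i) S L (h i) (R i) (C i) (F i) (T i)) \<and>
        (\<forall>i\<in>{1..n}. \<forall>j\<in>{1..n}. i \<noteq> j \<longrightarrow>
           R i \<inter> R j = {} \<and> C i \<inter> C j = {} \<and> F i \<inter> F j = {} \<and> T i \<inter> T j = {}))"

end

theory Submission
  imports Defs
begin

text \<open>
  Let \<open>W\<close> be the set of the \<open>N - d\<close> symbols that occur in no subcube indexed by \<open>D\<close>, where
  \<open>d\<close> is the sum of the orders of these subcubes.  Every line of the cube contains each symbol
  once, so \<open>N\<^sup>2 (N - d)\<close> cells carry a symbol in \<open>W\<close>.  Among them are all cells of the subcubes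
  not indexed by \<open>D\<close>.  For \<open>i \<in> D\<close> there are moreover, in each of the three directions,
  \<open>h i\<^sup>2\<close> lines meeting the \<open>i\<close>-th subcube, and each has \<open>N - d\<close> cells with a symbol in \<open>W\<close>.
  These lie outside the \<open>i\<close>-th subcube, whose symbols are not in \<open>W\<close>, so no cell is counted
  twice: two coordinates lie in the index sets of the \<open>i\<close>-th subcube and the third does not.
\<close>

text \<open>Each line \<open>g a b\<close> is a bijection onto \<open>S\<close>, so the preimage of
  \<open>W\<close> on it has \<open>card W\<close> elements; summing over the lines gives the
  product. Leaving \<open>g\<close> arbitrary lets the same count serve all three
  directions.\<close>

lemma card_cells_on_lines:
  assumes "finite A" "finite B" "finite I" "W \<subseteq> S"
    and bij: "\<And>a b. a \<in> A \<Longrightarrow> b \<in> B \<Longrightarrow> bij_betw (g a b) I S"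
  shows "card {(a, b, x). a \<in> A \<and> b \<in> B \<and> x \<in> I \<and> g a b x \<in> W} = card A * card B * card W"
proof -
  have line: "card {x \<in> I. g a b x \<in> W} = card W" if "a \<in> A" "b \<in> B" for a b
  proof -
    have "bij_betw (g a b) {x \<in> I. g a b x \<in> W} W"
      using bij[OF that] \<open>W \<subseteq> S\<close> unfolding bij_betw_def inj_on_def by auto
    then show ?thesis by (rule bij_betw_same_card)
  qed
  have "{(a, b, x). a \<in> A \<and> b \<in> B \<and> x \<in> I \<and> g a b x \<in> W}
      = (SIGMA a:A. SIGMA b:B. {x \<in> I. g a b x \<in> W})" by auto
  then show ?thesis using assms(1-3) by (simp add: line)
qed

text \<open>A line has as many cells as there are symbols, and \<open>S\<close> is finite, so
  injectivity already forces every symbol to occur on it.\<close>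

lemma latin_array_bij_betw:
  assumes "latin_array R C F S m L"
  shows "\<And>r c. r \<in> R \<Longrightarrow> c \<in> C \<Longrightarrow> bij_betw (\<lambda>f. L r c f) F S"
    and "\<And>r f. r \<in> R \<Longrightarrow> f \<in> F \<Longrightarrow> bij_betw (\<lambda>c. L r c f) C S"
    and "\<And>c f. c \<in> C \<Longrightarrow> f \<in> F \<Longrightarrow> bij_betw (\<lambda>r. L r c f) R S"
proof -
  have bij: "bij_betw g X S"
    if "inj_on g X" "g ` X \<subseteq> S" "finite S" "card X = card S" for g :: "'a \<Rightarrow> 'b" and X
    using that unfolding bij_betw_def by (metis card_image card_subset_eq)
  show "\<And>r c. r \<in> R \<Longrightarrow> c \<in> C \<Longrightarrow> bij_betw (\<lambda>f. L r c f) F S"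
    "\<And>r f. r \<in> R \<Longrightarrow> f \<in> F \<Longrightarrow> bij_betw (\<lambda>c. L r c f) C S"
    "\<And>c f. c \<in> C \<Longrightarrow> f \<in> F \<Longrightarrow> bij_betw (\<lambda>r. L r c f) R S"
    using assms by (auto simp: latin_array_def intro!: bij)
qed

text \<open>Full index sets give the count for the whole cube, index sets of a subcube the count for
  the lines through it. All cells are written in the order (row, column, file), so that sets from
  different directions can be compared; the last two parts therefore permute the triples.\<close>

lemma card_cells_with_symbols:
  assumes "latin_array R C F S m L" "W \<subseteq> S"
  shows "X \<subseteq> R \<Longrightarrow> Y \<subseteq> C \<Longrightarrow>
           card {(r, c, f). r \<in> X \<and> c \<in> Y \<and> f \<in> F \<and> L r c f \<in> W} = card X * card Y * card W"
    and "X \<subseteq> R \<Longrightarrow> Z \<subseteq> F \<Longrightarrow>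
           card {(r, c, f). r \<in> X \<and> c \<in> C \<and> f \<in> Z \<and> L r c f \<in> W} = card X * card Z * card W"
    and "Y \<subseteq> C \<Longrightarrow> Z \<subseteq> F \<Longrightarrow>
           card {(r, c, f). r \<in> R \<and> c \<in> Y \<and> f \<in> Z \<and> L r c f \<in> W} = card Y * card Z * card W"
proof -
  have fin: "finite R" "finite C" "finite F" using assms(1) by (auto simp: latin_array_def)
  note bij = latin_array_bij_betw[OF assms(1)]
  show "card {(r, c, f). r \<in> X \<and> c \<in> Y \<and> f \<in> F \<and> L r c f \<in> W} = card X * card Y * card W"
    if "X \<subseteq> R" "Y \<subseteq> C"
    by (rule card_cells_on_lines) (use that fin assms(2) in \<open>auto intro: finite_subset bij\<close>)
  show "card {(r, c, f). r \<in> X \<and> c \<in> C \<and> f \<in> Z \<and> L r c f \<in> W} = card X * card Z * card W"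
    if "X \<subseteq> R" "Z \<subseteq> F"
  proof -
    have "card {(r, f, c). r \<in> X \<and> f \<in> Z \<and> c \<in> C \<and> L r c f \<in> W} = card X * card Z * card W"
      by (rule card_cells_on_lines) (use that fin assms(2) in \<open>auto intro: finite_subset bij\<close>)
    moreover have "bij_betw (\<lambda>(r, f, c). (r, c, f))
      {(r, f, c). r \<in> X \<and> f \<in> Z \<and> c \<in> C \<and> L r c f \<in> W}
      {(r, c, f). r \<in> X \<and> c \<in> C \<and> f \<in> Z \<and> L r c f \<in> W}"
      by (rule bij_betw_byWitness[where f' = "\<lambda>(r, c, f). (r, f, c)"]) auto
    ultimately show ?thesis by (auto dest!: bij_betw_same_card)
  qed
  show "card {(r, c, f). r \<in> R \<and> c \<in> Y \<and> f \<in> Z \<and> L r c f \<in> W} = card Y * card Z * card W"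
    if "Y \<subseteq> C" "Z \<subseteq> F"
  proof -
    have "card {(c, f, r). c \<in> Y \<and> f \<in> Z \<and> r \<in> R \<and> L r c f \<in> W} = card Y * card Z * card W"
      by (rule card_cells_on_lines) (use that fin assms(2) in \<open>auto intro: finite_subset bij\<close>)
    moreover have "bij_betw (\<lambda>(c, f, r). (r, c, f))
      {(c, f, r). c \<in> Y \<and> f \<in> Z \<and> r \<in> R \<and> L r c f \<in> W}
      {(r, c, f). r \<in> R \<and> c \<in> Y \<and> f \<in> Z \<and> L r c f \<in> W}"
      by (rule bij_betw_byWitness[where f' = "\<lambda>(r, c, f). (c, f, r)"]) auto
    ultimately show ?thesis by (auto dest!: bij_betw_same_card)
  qed
qed

theorem theorem10:
  fixes n N :: nat and h :: "nat \<Rightarrow> nat" and D :: "nat set"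
  assumes "n \<ge> 1"
    and "\<forall>i\<in>{1..n}. \<forall>j\<in>{1..n}. i \<le> j \<longrightarrow> h i \<ge> h j"
    and "h n > 0"
    and "N = (\<Sum>i=1..n. h i)"
    and "\<exists>(S :: 's set) L. is_LC n h S L"
    and "D \<subseteq> {1..n}"
  shows "int N ^ 3 - (\<Sum>i=1..n. int (h i) ^ 3) \<ge>
           int N ^ 2 * (\<Sum>i\<in>D. int (h i))
           + 3 * (\<Sum>i\<in>D. int (h i) ^ 2) * (int N - (\<Sum>i\<in>D. int (h i)))
           - (\<Sum>i\<in>D. int (h i) ^ 3)"
proof -
  from assms(5) obtain S :: "'s set" and L where "is_LC n h S L" by blast
  note LC = this[unfolded is_LC_def latin_cube_def, folded assms(4)]
  then have cube: "latin_array {1..N} {1..N} {1..N} S N L" by (rule conjunct1)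
  from LC[THEN conjunct2] obtain R C F T
    where sub: "\<And>i. i \<in> {1..n} \<Longrightarrow> subcube N S L (h i) (R i) (C i) (F i) (T i)"
      and disj: "\<And>i j. i \<in> {1..n} \<Longrightarrow> j \<in> {1..n} \<Longrightarrow> i \<noteq> j \<Longrightarrow>
        R i \<inter> R j = {} \<and> C i \<inter> C j = {} \<and> F i \<inter> F j = {} \<and> T i \<inter> T j = {}"
    by metis
  have fin: "finite (R i)" "finite (C i)" "finite (F i)" "finite (T i)"
    and card: "card (R i) = h i" "card (C i) = h i" "card (F i) = h i" "card (T i) = h i"
    and subset: "R i \<subseteq> {1..N}" "C i \<subseteq> {1..N}" "F i \<subseteq> {1..N}" "T i \<subseteq> S"
    and symb: "\<And>r c f. r \<in> R i \<Longrightarrow> c \<in> C i \<Longrightarrow> f \<in> F i \<Longrightarrow> L r c f \<in> T i"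
    if "i \<in> {1..n}" for i
    using sub[OF that] by (auto simp: subcube_def latin_array_def)
  have finS: "finite S" and cardS: "card S = N" using cube by (auto simp: latin_array_def)
  have uniq: "i = j" if "i \<in> {1..n}" "j \<in> {1..n}"
    "x \<in> R i \<and> x \<in> R j \<or> x \<in> C i \<and> x \<in> C j \<or> x \<in> F i \<and> x \<in> F j" for i j x
    using disj that by blast
  have D: "i \<in> {1..n}" if "i \<in> D" for i using assms(6) that by auto
  have finD: "finite D" using assms(6) finite_subset by blast
  define d where "d = (\<Sum>i\<in>D. h i)"
  define W where "W = S - (\<Union>i\<in>D. T i)"
  have "card (\<Union>i\<in>D. T i) = d"
    unfolding d_def using fin(4) D disj finD by (subst card_UN_disjoint) (auto simp: card(4))
  moreover have TS: "(\<Union>i\<in>D. T i) \<subseteq> S" using subset(4) D by blast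
  ultimately have d_le: "d \<le> N" and cardW: "card W = N - d"
    using card_mono[OF finS TS] card_Diff_subset[OF finite_subset[OF TS finS] TS]
    by (simp_all add: W_def cardS)
  have WS: "W \<subseteq> S" by (auto simp: W_def)
  have not_W: "L r c f \<notin> W" if "i \<in> D" "r \<in> R i" "c \<in> C i" "f \<in> F i" for i r c f
    using symb[OF D[OF that(1)]] that by (auto simp: W_def)
  \<comment> \<open>The symbols of a subcube outside \<open>D\<close> avoid every \<open>T j\<close>
    with \<open>j \<in> D\<close>, because distinct subcubes share no symbol.\<close>
  have in_W: "L r c f \<in> W" if "i \<in> {1..n} - D" "r \<in> R i" "c \<in> C i" "f \<in> F i" for i r c f
  proof -
    have "i \<in> {1..n}" using that by simp
    then have "L r c f \<in> T i" "L r c f \<in> S" using symb subset(4) that by blast+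
    moreover have "L r c f \<notin> T j" if "j \<in> D" for j
      using \<open>L r c f \<in> T i\<close> disj[of i j] D[OF that] that \<open>i \<in> {1..n} - D\<close> by blast
    ultimately show ?thesis by (auto simp: W_def)
  qed
  define Y where
    "Y = {(r, c, f). r \<in> {1..N} \<and> c \<in> {1..N} \<and> f \<in> {1..N} \<and> L r c f \<in> W}"
  \<comment> \<open>The second letter names the coordinate that runs freely over the cube; the other
    two stay in the index sets of the subcube \<open>i\<close>.\<close>
  define PF where "PF i = {(r, c, f). r \<in> R i \<and> c \<in> C i \<and> f \<in> {1..N} \<and> L r c f \<in> W}" for i
  define PC where "PC i = {(r, c, f). r \<in> R i \<and> c \<in> {1..N} \<and> f \<in> F i \<and> L r c f \<in> W}" for i
  define PR where "PR i = {(r, c, f). r \<in> {1..N} \<and> c \<in> C i \<and> f \<in> F i \<and> L r c f \<in> W}" for i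
  define Q where "Q i = R i \<times> C i \<times> F i" for i
  note defs = Y_def PF_def PC_def PR_def Q_def
  note cells = card_cells_with_symbols[OF cube WS]
  have cY: "card Y = N * N * (N - d)"
    unfolding Y_def using cells(1)[of "{1..N}" "{1..N}"] cardW by simp
  have "Y \<subseteq> {1..N} \<times> {1..N} \<times> {1..N}" by (auto simp: Y_def)
  then have finY: "finite Y" by (rule finite_subset) simp
  have cP: "card (PF i) = h i * h i * (N - d)" "card (PC i) = h i * h i * (N - d)"
    "card (PR i) = h i * h i * (N - d)" if "i \<in> D" for i
    unfolding PF_def PC_def PR_def
    using cells(1)[of "R i" "C i"] cells(2)[of "R i" "F i"] cells(3)[of "C i" "F i"]
      D[OF that] subset card cardW by simp_all
  have P_Y: "PF i \<subseteq> Y" "PC i \<subseteq> Y" "PR i \<subseteq> Y" if "i \<in> D" for i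
    using subset[OF D[OF that]] by (auto simp: defs)
  have Q_Y: "Q i \<subseteq> Y" if "i \<in> {1..n} - D" for i
    using subset[of i] in_W[OF that] that by (auto simp: defs)
  have finP: "finite (PF i)" "finite (PC i)" "finite (PR i)" if "i \<in> D" for i
    by (rule finite_subset[OF _ finY], fact P_Y[OF that])+
  have P_inter: "PF i \<inter> PF j = {}" "PC i \<inter> PC j = {}" "PR i \<inter> PR j = {}"
    if "i \<in> D" "j \<in> D" "i \<noteq> j" for i j
    using disj[of i j] D that by (auto simp: defs)
  \<comment> \<open>Two different directions still restrict one coordinate in common, so a shared
    cell forces \<open>i = j\<close> by \<open>uniq\<close>. Then all three coordinates lie in
    subcube \<open>i\<close>, contradicting \<open>not_W\<close>.\<close>
  have PP: "PF i \<inter> PC j = {}" "PF i \<inter> PR j = {}" "PC i \<inter> PR j = {}"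
    if "i \<in> D" "j \<in> D" for i j
    using uniq[OF D[OF that(1)] D[OF that(2)]] not_W[OF that(1)] unfolding defs by blast+
  \<comment> \<open>Here \<open>i \<noteq> j\<close>, since only \<open>i\<close> is in
    \<open>D\<close>, and \<open>Q j\<close> restricts every coordinate, so the disjoint index sets
    of the two subcubes exclude a common cell.\<close>
  have PQ: "PF i \<inter> Q j = {}" "PC i \<inter> Q j = {}" "PR i \<inter> Q j = {}"
    if "i \<in> D" "j \<in> {1..n} - D" for i j
    using disj[of i j] D that by (auto simp: defs)
  have cU: "card (\<Union>i\<in>D. PF i) = (\<Sum>i\<in>D. h i * h i * (N - d))"
    "card (\<Union>i\<in>D. PC i) = (\<Sum>i\<in>D. h i * h i * (N - d))"
    "card (\<Union>i\<in>D. PR i) = (\<Sum>i\<in>D. h i * h i * (N - d))"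
    by (subst card_UN_disjoint; use finD finP P_inter cP in auto)+
  have finQ: "finite (Q i)" if "i \<in> {1..n} - D" for i
    by (rule finite_subset[OF Q_Y[OF that] finY])
  have Q_inter: "Q i \<inter> Q j = {}" if "i \<in> {1..n} - D" "j \<in> {1..n} - D" "i \<noteq> j" for i j
    using disj[of i j] that by (auto simp: Q_def)
  have "card (\<Union>i\<in>{1..n} - D. Q i) = (\<Sum>i\<in>{1..n} - D. card (Q i))"
    by (rule card_UN_disjoint) (use finQ Q_inter in blast)+
  then have cQ: "card (\<Union>i\<in>{1..n} - D. Q i) = (\<Sum>i\<in>{1..n} - D. h i ^ 3)"
    by (simp add: Q_def card_cartesian_product card power3_eq_cube mult.assoc)
  let ?F = "\<Union>i\<in>D. PF i" and ?C = "\<Union>i\<in>D. PC i" and ?R = "\<Union>i\<in>D. PR i"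
    and ?Q = "\<Union>i\<in>{1..n} - D. Q i"
  have finU: "finite ?F" "finite ?C" "finite ?R" "finite ?Q"
    using finD finP finQ by auto
  have "card (?F \<union> ?C \<union> ?R \<union> ?Q) = card (?F \<union> ?C \<union> ?R) + card ?Q"
    using PQ by (intro card_Un_disjoint finite_UnI finU) blast
  also have "card (?F \<union> ?C \<union> ?R) = card (?F \<union> ?C) + card ?R"
    using PP by (intro card_Un_disjoint finite_UnI finU) blast
  also have "card (?F \<union> ?C) = card ?F + card ?C"
    using PP by (intro card_Un_disjoint finU) blast
  finally have "card ?F + card ?C + card ?R + card ?Q = card (?F \<union> ?C \<union> ?R \<union> ?Q)" by simp
  also have "\<dots> \<le> card Y"
    by (rule card_mono[OF finY]) (use P_Y Q_Y in blast)
  finally have "3 * ((\<Sum>i\<in>D. h i * h i) * (N - d)) + (\<Sum>i\<in>{1..n} - D. h i ^ 3) \<le> N * N * (N - d)"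
    unfolding cU cQ cY by (simp add: sum_distrib_right)
  then have "int (3 * ((\<Sum>i\<in>D. h i * h i) * (N - d)) + (\<Sum>i\<in>{1..n} - D. h i ^ 3))
      \<le> int (N * N * (N - d))" by (rule of_nat_mono)
  \<comment> \<open>By \<open>d_le\<close> the truncated difference \<open>N - d\<close> becomes a
    true integer difference. What remains is to write the sum over the complement of
    \<open>D\<close> as a difference and to move \<open>N^2 * d\<close> and the full sum of cubes
    across.\<close>
  then have "3 * (\<Sum>i\<in>D. int (h i) ^ 2) * (int N - int d) + (\<Sum>i\<in>{1..n} - D. int (h i) ^ 3)
      \<le> int N ^ 2 * (int N - int d)"
    using d_le by (simp add: of_nat_diff power2_eq_square mult.assoc)
  moreover have "(\<Sum>i\<in>{1..n} - D. int (h i) ^ 3)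
      = (\<Sum>i=1..n. int (h i) ^ 3) - (\<Sum>i\<in>D. int (h i) ^ 3)"
    using assms(6) by (simp add: sum_diff)
  moreover have "int N ^ 2 * (int N - int d) = int N ^ 3 - int N ^ 2 * int d"
    by (simp add: algebra_simps power2_eq_square power3_eq_cube)
  moreover have dsum: "(\<Sum>i\<in>D. int (h i)) = int d" by (simp add: d_def)
  ultimately show ?thesis unfolding dsum by linarith
qed

end
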